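(* Let $\mathcal{A}:\mathbb{R}^{m\times n}\to\mathbb{R}^p$ be a linear map and suppose that $b=\mathcal{A}X+e$, where $X\in\mathbb{R}^{m\times n}$ is an arbitrary matrix and $e\in\mathbb{R}^p$. Let $X_r$ be the best rank-$r$ approximation to $X$. Suppose $\mathcal{A}$ has the restricted isometry property with $\delta_{3r}(\mathcal{A})\le\alpha/\sqrt{8}$, where $\alpha\in(0,1)$. Consider the algorithm FPCAr (defined in the context) with data $\mathcal{A},b,r$, initial matrix $X^0$ and parameters $\mu_1>\mu_2>\cdots>\mu_L=\bar\mu$, and suppose that in FPCAr, after $K_j$ iterations with fixed $\mu=\mu_j$, we obtain a solution $X_{(j)}^{(K_j)}$ that is then set to the initial point $X_{(j+1)}^0$ for the next continuation subproblem $\mu=\mu_{j+1}$. Then FPCAr will recover an approximation $X_{(L)}^{(K_L)}$ that satisfies $$\left\|X-X_{(L)}^{(K_L)}\right\|_F\le\left(\alpha^{\sum_{j=1}^LK_j}\right)\|X_r-X^0\|_F+\left(\left(\sum_{j=2}^L\alpha^{\sum_{l=j}^LK_l}+1\right)\gamma+1\right)\tilde{\epsilon}_r+\left(\sum_{j=2}^L\left(\alpha^{\sum_{l=j}^LK_l}\right)\mu_{j-1}+\mu_L\right)\frac{2\sqrt{m}}{1-\alpha},$$ where $\gamma:=\frac{\beta^2}{2(1-\alpha)}+1$, $\beta:=2\sqrt{1+\alpha/\sqrt{8}}$, and $$\tilde{\epsilon}_r=\|X-X_r\|_F+\frac{1}{\sqrt{r}}\|X-X_r\|_*+\|e\|_2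 .$$
   Context: Throughout $m\le n$. $\|\cdot\|_F$ is the Frobenius norm on $\mathbb{R}^{m\times n}$ (with inner product $\langle X,Y\rangle=\mathrm{Tr}(X^\top Y)$), $\|\cdot\|_*$ is the nuclear norm (sum of singular values), $\|\cdot\|_2$ is the Euclidean norm on $\mathbb{R}^p$, and $\mathcal{A}^*:\mathbb{R}^p\to\mathbb{R}^{m\times n}$ is the adjoint of $\mathcal{A}$. $\mathcal{A}X$ means $\mathcal{A}(X)$. Restricted isometry constant: for an integer $s$ with $1\le s\le m$, $\delta_s(\mathcal{A})$ is the minimum constant such that $(1-\delta_s(\mathcal{A}))\|X\|_F^2\le\|\mathcal{A}X\|_2^2\le(1+\delta_s(\mathcal{A}))\|X\|_F^2$ for all $X\in\mathbb{R}^{m\times n}$ with $\mathrm{rank}(X)\le s$. Best rank-$r$ approximation (hard thresholding): if $X=\sum_{i=1}^m\sigma_iu_iv_i^\top$ is the singular value decomposition of $X$ with $\sigma_1\ge\cdots\ge\sigma_m$, then $R_r(X)=\sum_{i=1}^r\sigma_iu_iv_i^\top$. Matrix shrinkage operator (soft thresholding): if $X=U\,\mathrm{Diag}(\sigma)V^\top$ is the singular value decomposition of $X$ and $\nu>0$, then $S_\nu(X)=U\,\mathrm{Diag}((\sigma-\nu)_+)V^\top$, where $a_+:=\max(a,0)$ is applied componentwise. Algorithm FPCAr (fixed-point continuation with given rank $r$ and unit stepsize): the input is an initial matrix $X^0=X_{(1)}^0\in\mathbb{R}^{m\times n}$, the rank $r$, and $\mu_1>\mu_2>\cdots>\mu_L=\bar\mu>0$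 (consecutive values are related by $\mu_{j+1}=\max\{\mu_j\eta_\mu,\bar\mu\}$, where the parameter $\eta_\mu$ determines the rate of reduction). For $j=1,\ldots,L$: set $\mu=\mu_j$; for $k=0,1,\ldots,K_j-1$ set $Y_{(j)}^{k+1}:=X_{(j)}^k-\mathcal{A}^*(\mathcal{A}X_{(j)}^k-b)$ and $X_{(j)}^{k+1}:=S_\mu(R_r(Y_{(j)}^{k+1}))$; the $K_j$-th iterate is denoted $X_{(j)}^{(K_j)}$, and $X_{(j+1)}^0:=X_{(j)}^{(K_j)}$.
   Formalization: The formal theorem adds the hypothesis that the initial matrix X^0 has rank at most r; for initial matrices of arbitrary rank the stated bound fails (e.g. X = 0, r = 1, X^0 the 100×100 identity, one iteration). *)

theory Defs
  imports "HOL-Analysis.Analysis"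
begin

text \<open>
  An \<open>m \<times> n\<close> matrix is an element of \<open>real^'n^'m\<close>, with \<open>m = CARD('m)\<close> and \<open>n = CARD('n)\<close>.
  The library's norm and inner product on this type are the Frobenius norm and the trace
  inner product, as the next two lemmas confirm; hence \<open>adjoint\<close> is the adjoint
  with respect to the latter.
\<close>

lemma inner_matrix_eq_trace:
  fixes X Y :: "real^'n^'m"
  shows "X \<bullet> Y = trace (transpose X ** Y)"
  unfolding trace_def transpose_def matrix_matrix_mult_def inner_vec_def
  by (simp add: sum.swap[of _ "UNIV :: 'n set"])

lemma norm_matrix_eq_frobenius:
  fixes X :: "real^'n^'m"
  shows "norm X = sqrt (\<Sum>i\<in>UNIV. \<Sum>j\<in>UNIV. (X $ i $ j)\<^sup>2)"
  by (simp add: norm_eq_sqrt_inner inner_vec_def power2_eq_square)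

text \<open>
  \<open>is_svd X \<sigma> u v\<close>: the data \<open>\<sigma> i\<close>, \<open>u i\<close>, \<open>v i\<close> with \<open>1 \<le> i \<le> m\<close> form a singular value
  decomposition of \<open>X\<close>. Intended for \<open>m \<le> n\<close>, as there are \<open>m\<close> right singular vectors.
\<close>

definition is_svd ::
  "real^'n^'m \<Rightarrow> (nat \<Rightarrow> real) \<Rightarrow> (nat \<Rightarrow> real^'m) \<Rightarrow> (nat \<Rightarrow> real^'n) \<Rightarrow> bool" where
  "is_svd X \<sigma> u v \<longleftrightarrow>
     (\<forall>i\<in>{1..CARD('m)}. 0 \<le> \<sigma> i) \<and>
     (\<forall>i\<in>{1..CARD('m)}. \<forall>j\<in>{1..CARD('m)}. i \<le> j \<longrightarrow> \<sigma> j \<le> \<sigma> i) \<and>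
     (\<forall>i\<in>{1..CARD('m)}. \<forall>j\<in>{1..CARD('m)}. u i \<bullet> u j = (if i = j then 1 else 0)) \<and>
     (\<forall>i\<in>{1..CARD('m)}. \<forall>j\<in>{1..CARD('m)}. v i \<bullet> v j = (if i = j then 1 else 0)) \<and>
     X = (\<Sum>i=1..CARD('m). \<sigma> i *\<^sub>R ((columnvector (u i) :: real^1^'m) ** rowvector (v i)))"

text \<open>The sum does not depend on the chosen decomposition.\<close>

definition nuclear_norm :: "real^'n^'m \<Rightarrow> real" where
  "nuclear_norm X = (THE s. \<exists>\<sigma> u v. is_svd X \<sigma> u v \<and> s = (\<Sum>i=1..CARD('m). \<sigma> i))"

text \<open>
  \<open>is_hard_threshold r X Z\<close> means \<open>Z = R\<^sub>r(X)\<close>. It is a relation since \<open>R\<^sub>r(X)\<close> depends on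
  the chosen decomposition when the \<open>r\<close>-th and \<open>(r + 1)\<close>-st singular values of \<open>X\<close> coincide.
\<close>

definition is_hard_threshold :: "nat \<Rightarrow> real^'n^'m \<Rightarrow> real^'n^'m \<Rightarrow> bool" where
  "is_hard_threshold r X Z \<longleftrightarrow>
     (\<exists>\<sigma> u v. is_svd X \<sigma> u v \<and>
        Z = (\<Sum>i=1..r. \<sigma> i *\<^sub>R ((columnvector (u i) :: real^1^'m) ** rowvector (v i))))"

text \<open>\<open>is_shrinkage \<nu> X Z\<close> means \<open>Z = S\<^sub>\<nu>(X)\<close>.\<close>

definition is_shrinkage :: "real \<Rightarrow> real^'n^'m \<Rightarrow> real^'n^'m \<Rightarrow> bool" where
  "is_shrinkage \<nu> X Z \<longleftrightarrow>
     (\<exists>\<sigma> u v. is_svd X \<sigma> u v \<and>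
        Z = (\<Sum>i=1..CARD('m). max (\<sigma> i - \<nu>) 0 *\<^sub>R
               ((columnvector (u i) :: real^1^'m) ** rowvector (v i))))"

definition ric :: "(real^'n^'m \<Rightarrow> real^'p) \<Rightarrow> nat \<Rightarrow> real" where
  "ric A s = (LEAST \<delta>. \<forall>X. rank X \<le> s \<longrightarrow>
     (1 - \<delta>) * (norm X)\<^sup>2 \<le> (norm (A X))\<^sup>2 \<and> (norm (A X))\<^sup>2 \<le> (1 + \<delta>) * (norm X)\<^sup>2)"

definition fpcar_step ::
  "(real^'n^'m \<Rightarrow> real^'p) \<Rightarrow> real^'p \<Rightarrow> nat \<Rightarrow> real \<Rightarrow> real^'n^'m \<Rightarrow> real^'n^'m \<Rightarrow> bool" where
  "fpcar_step A b r \<mu> X X' \<longleftrightarrow>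
     (\<exists>Y Z. Y = X - adjoint A (A X - b) \<and> is_hard_threshold r Y Z \<and> is_shrinkage \<mu> Z X')"

definition continuation_schedule :: "nat \<Rightarrow> (nat \<Rightarrow> real) \<Rightarrow> real \<Rightarrow> real \<Rightarrow> bool" where
  "continuation_schedule L \<mu> \<eta> \<mu>bar \<longleftrightarrow>
     1 \<le> L \<and> 0 < \<mu>bar \<and> \<mu> L = \<mu>bar \<and>
     (\<forall>j\<in>{1..<L}. \<mu> (Suc j) < \<mu> j \<and> \<mu> (Suc j) = max (\<mu> j * \<eta>) \<mu>bar)"

text \<open>
  \<open>fpcar_run A b r X0 L \<mu> K Xs\<close>: the matrices \<open>Xs j k\<close> with \<open>1 \<le> j \<le> L\<close>, \<open>0 \<le> k \<le> K j\<close>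
  are the iterates \<open>X\<^sub>(\<^sub>j\<^sub>)\<^sup>k\<close> of a run of FPCAr, for some choice of \<open>R\<^sub>r\<close> in every iteration.
  All iterates after the first step have rank at most \<open>r\<close>. The initial matrix need not, and
  the error bound is false without the hypothesis \<open>rank X0 \<le> r\<close>: the constant
  \<open>ric A (3 * r)\<close> controls \<open>Xr - Xs j k\<close> only if that difference has low rank.
\<close>

definition fpcar_run ::
  "(real^'n^'m \<Rightarrow> real^'p) \<Rightarrow> real^'p \<Rightarrow> nat \<Rightarrow> real^'n^'m \<Rightarrow>
   nat \<Rightarrow> (nat \<Rightarrow> real) \<Rightarrow> (nat \<Rightarrow> nat) \<Rightarrow> (nat \<Rightarrow> nat \<Rightarrow> real^'n^'m) \<Rightarrow> bool" where
  "fpcar_run A b r X0 L \<mu> K Xs \<longleftrightarrow>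
     Xs 1 0 = X0 \<and>
     (\<forall>j\<in>{1..L}. \<forall>k<K j. fpcar_step A b r (\<mu> j) (Xs j k) (Xs j (Suc k))) \<and>
     (\<forall>j\<in>{1..<L}. Xs (Suc j) 0 = Xs j (K j))"

end

theory Submission
  imports Defs
begin

text \<open>
  Since \<open>X\<^sub>r\<close> has rank at most \<open>r\<close>, \<open>Z = R\<^sub>r(Y)\<close> is at least as close to \<open>Y\<close> as \<open>X\<^sub>r\<close> is, which
  expands to \<open>\<parallel>Z - X\<^sub>r\<parallel>\<^sup>2 \<le> 2 \<langle>Z - X\<^sub>r, Y - X\<^sub>r\<rangle>\<close>. With \<open>e' = A(X - X\<^sub>r) + e\<close> the right-hand side is
  \<open>2 (\<langle>D, W\<rangle> - \<langle>A D, A W\<rangle> + \<langle>A D, e'\<rangle>)\<close> for \<open>D = Z - X\<^sub>r\<close> and \<open>W = X\<^sup>k - X\<^sub>r\<close>, whose combinations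
  have rank at most \<open>3r\<close>; the polarised isometry property turns this into
  \<open>\<parallel>D\<parallel> \<le> 2 \<delta> \<parallel>W\<parallel> + 2 sqrt (1 + \<delta>) \<parallel>e'\<parallel>\<close>. Shrinkage costs another \<open>sqrt m * \<mu>\<close>, and \<open>2 \<delta> \<le> \<alpha>\<close> makes
  the iteration an affine contraction, which is summed over the continuation stages. Cutting
  \<open>X - X\<^sub>r\<close> into blocks of \<open>r\<close> consecutive singular values gives \<open>\<parallel>e'\<parallel> \<le> sqrt (1 + \<delta>) * \<epsilon>\<close>.
\<close>

subsection \<open>Orthonormal families\<close>

definition orthonormal_on :: "'i set \<Rightarrow> ('i \<Rightarrow> 'a::real_inner) \<Rightarrow> bool" where
  "orthonormal_on I f \<longleftrightarrow> (\<forall>i\<in>I. \<forall>j\<in>I. f i \<bullet> f j = (if i = j then 1 else 0))"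

lemma orthonormal_on_subset: "orthonormal_on I f \<Longrightarrow> J \<subseteq> I \<Longrightarrow> orthonormal_on J f"
  by (simp add: orthonormal_on_def subset_iff)

text \<open>Serves to permute singular vectors when the decomposition of a residual is put in
  order.\<close>

lemma orthonormal_on_reindex:
  assumes "orthonormal_on I f" "inj_on p J" "p ` J \<subseteq> I"
  shows "orthonormal_on J (\<lambda>i. f (p i))"
  unfolding orthonormal_on_def
proof (intro ballI)
  fix i j assume ij: "i \<in> J" "j \<in> J"
  then have "p i \<in> I" "p j \<in> I" "p i = p j \<longleftrightarrow> i = j"
    using assms(2,3) by (auto simp: inj_on_eq_iff)
  then show "f (p i) \<bullet> f (p j) = (if i = j then 1 else 0)"
    using assms(1) by (simp add: orthonormal_on_def)
qed

lemma norm_orthonormal_on: "orthonormal_on I f \<Longrightarrow> i \<in> I \<Longrightarrow> norm (f i) = 1"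
  by (simp add: orthonormal_on_def norm_eq_1)

lemma inner_orthonormal_sum:
  assumes "orthonormal_on I f" "finite I" "i \<in> I"
  shows "f i \<bullet> (\<Sum>j\<in>I. a j *\<^sub>R f j) = a i"
proof -
  have "f i \<bullet> (\<Sum>j\<in>I. a j *\<^sub>R f j) = (\<Sum>j\<in>I. if j = i then a j else 0)"
    unfolding inner_sum_right using assms by (intro sum.cong) (auto simp: orthonormal_on_def)
  also have "\<dots> = a i" using assms by simp
  finally show ?thesis .
qed

lemma norm_orthonormal_sum:
  assumes "orthonormal_on I f" "finite I"
  shows "(norm (\<Sum>i\<in>I. a i *\<^sub>R f i))\<^sup>2 = (\<Sum>i\<in>I. (a i)\<^sup>2)"
proof -
  have "(norm (\<Sum>i\<in>I. a i *\<^sub>R f i))\<^sup>2 = (\<Sum>i\<in>I. a i * (f i \<bullet> (\<Sum>j\<in>I. a j *\<^sub>R f j)))"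
    unfolding power2_norm_eq_inner by (subst inner_sum_left) simp
  also have "\<dots> = (\<Sum>i\<in>I. (a i)\<^sup>2)"
    using assms by (intro sum.cong) (auto simp: inner_orthonormal_sum power2_eq_square)
  finally show ?thesis .
qed

text \<open>Completing the square in each coefficient \<open>a i\<close>. The choice
  \<open>a i = f i \<bullet> x\<close> gives Bessel's inequality; dropping the last sum gives a
  lower bound for the distance to a subspace.\<close>

lemma power2_dist_orthonormal_sum:
  assumes "orthonormal_on I f" "finite I"
  shows "(norm (x - (\<Sum>i\<in>I. a i *\<^sub>R f i)))\<^sup>2
    = (norm x)\<^sup>2 - (\<Sum>i\<in>I. (f i \<bullet> x)\<^sup>2) + (\<Sum>i\<in>I. (a i - f i \<bullet> x)\<^sup>2)"
proof -
  have "(norm (x - (\<Sum>i\<in>I. a i *\<^sub>R f i)))\<^sup>2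
      = (norm x)\<^sup>2 + (norm (\<Sum>i\<in>I. a i *\<^sub>R f i))\<^sup>2 - 2 * (\<Sum>i\<in>I. a i * (f i \<bullet> x))"
  proof -
    have "(norm (x - s))\<^sup>2 = (norm x)\<^sup>2 + (norm s)\<^sup>2 - 2 * (s \<bullet> x)" for s
      by (simp add: power2_norm_eq_inner inner_diff_left inner_diff_right inner_commute)
    then show ?thesis by (simp add: inner_sum_left)
  qed
  also have "(norm (\<Sum>i\<in>I. a i *\<^sub>R f i))\<^sup>2 = (\<Sum>i\<in>I. (a i)\<^sup>2)"
    by (rule norm_orthonormal_sum[OF assms])
  also have "(norm x)\<^sup>2 + (\<Sum>i\<in>I. (a i)\<^sup>2) - 2 * (\<Sum>i\<in>I. a i * (f i \<bullet> x))
      = (norm x)\<^sup>2 - (\<Sum>i\<in>I. (f i \<bullet> x)\<^sup>2) + (\<Sum>i\<in>I. (a i - f i \<bullet> x)\<^sup>2)"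
    by (simp add: power2_diff sum.distrib sum_subtractf sum_distrib_left mult.assoc)
  finally show ?thesis .
qed

lemma bessel_inequality:
  assumes "orthonormal_on I f" "finite I"
  shows "(\<Sum>i\<in>I. (f i \<bullet> x)\<^sup>2) \<le> (norm x)\<^sup>2"
proof -
  have "0 \<le> (norm (x - (\<Sum>i\<in>I. (f i \<bullet> x) *\<^sub>R f i)))\<^sup>2" by simp
  then show ?thesis unfolding power2_dist_orthonormal_sum[OF assms] by simp
qed

subsection \<open>Dyads and rank\<close>

abbreviation dyad :: "real^'m \<Rightarrow> real^'n \<Rightarrow> real^'n^'m" where
  "dyad u v \<equiv> (columnvector u :: real^1^'m) ** rowvector v"

lemma dyad_nth: "dyad u v $ i $ j = u $ i * v $ j"
  by (simp add: matrix_matrix_mult_def columnvector_def rowvector_def)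

lemma dyad_mult_vec: "dyad u v *v x = (v \<bullet> x) *\<^sub>R u"
  by (simp add: vec_eq_iff matrix_vector_mult_def dyad_nth inner_vec_def sum_distrib_right
      sum_distrib_left mult_ac)

lemma inner_dyad: "M \<bullet> dyad u v = u \<bullet> (M *v v)"
  by (simp add: inner_vec_def dyad_nth matrix_vector_mult_def sum_distrib_left mult_ac)

lemma sum_dyad_mult_vec:
  "(\<Sum>i\<in>I. a i *\<^sub>R dyad (u i) (v i)) *v x = (\<Sum>i\<in>I. (a i * (v i \<bullet> x)) *\<^sub>R u i)"
  by (induction I rule: infinite_finite_induct)
     (auto simp: matrix_vector_mult_add_rdistrib scaleR_matrix_vector_assoc[symmetric] dyad_mult_vec)

lemma orthonormal_on_dyad:
  assumes "orthonormal_on I u" "orthonormal_on I v"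
  shows "orthonormal_on I (\<lambda>i. dyad (u i) (v i))"
  using assms by (auto simp: orthonormal_on_def inner_dyad dyad_mult_vec)

text \<open>The entries of \<open>M *v v i\<close> are the inner products of the rows of
  \<open>M\<close> with \<open>v i\<close>, so this is Bessel's inequality summed over the
  rows.\<close>

lemma norm_ge_orthonormal_mult_vec:
  fixes M :: "real^'n^'m"
  assumes "orthonormal_on I v" "finite I"
  shows "(\<Sum>i\<in>I. (norm (M *v v i))\<^sup>2) \<le> (norm M)\<^sup>2"
proof -
  have "(\<Sum>i\<in>I. (norm (M *v v i))\<^sup>2) = (\<Sum>i\<in>I. \<Sum>k\<in>UNIV. (v i \<bullet> M $ k)\<^sup>2)"
  proof (rule sum.cong[OF refl])
    fix i
    have "(norm (M *v v i))\<^sup>2 = (\<Sum>k\<in>UNIV. ((M *v v i) $ k)\<^sup>2)"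
      unfolding power2_norm_eq_inner inner_vec_def by (simp add: power2_eq_square)
    then show "(norm (M *v v i))\<^sup>2 = (\<Sum>k\<in>UNIV. (v i \<bullet> M $ k)\<^sup>2)"
      by (simp only: matrix_vector_mul_component inner_commute)
  qed
  also have "\<dots> = (\<Sum>k\<in>UNIV. \<Sum>i\<in>I. (v i \<bullet> M $ k)\<^sup>2)" by (rule sum.swap)
  also have "\<dots> \<le> (\<Sum>k\<in>UNIV. (norm (M $ k))\<^sup>2)"
    by (intro sum_mono bessel_inequality assms)
  also have "\<dots> = (norm M)\<^sup>2"
    unfolding power2_norm_eq_inner inner_vec_def[of M M] ..
  finally show ?thesis .
qed

lemma rank_le_card:
  fixes M :: "real^'n^'m"
  assumes "\<And>x. M *v x \<in> span S" "finite S"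
  shows "rank M \<le> card S"
proof -
  have "range ((*v) M) \<subseteq> span S" using assms(1) by blast
  then show ?thesis unfolding rank_dim_range using assms(2) by (rule dim_le_card)
qed

lemma rank_le_rank:
  fixes M N :: "real^'n^'m"
  assumes "\<And>x. M *v x \<in> range ((*v) N)"
  shows "rank M \<le> rank N"
proof -
  have "range ((*v) M) \<subseteq> range ((*v) N)" using assms by blast
  then show ?thesis unfolding rank_dim_range by (rule dim_subset)
qed

lemma rank_scaleR_le: "rank (c *\<^sub>R M) \<le> rank M" for M :: "real^'n^'m"
proof (rule rank_le_rank)
  fix x show "(c *\<^sub>R M) *v x \<in> range ((*v) M)"
    by (rule range_eqI[of _ _ "c *\<^sub>R x"])
      (simp add: scaleR_matrix_vector_assoc[symmetric] matrix_vector_mult_scaleR)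
qed

lemma rank_spanning_set:
  fixes M :: "real^'n^'m"
  obtains B where "finite B" "range ((*v) M) \<subseteq> span B" "card B = rank M"
proof -
  obtain B where B: "B \<subseteq> range ((*v) M)" "independent B" "range ((*v) M) \<subseteq> span B"
    "card B = dim (range ((*v) M))"
    by (rule basis_exists)
  show ?thesis
    by (rule that[OF finiteI_independent[OF B(2)] B(3)]) (use B(4) rank_dim_range[of M] in argo)
qed

lemma rank_add_le: "rank (M + N) \<le> rank M + rank N" for M N :: "real^'n^'m"
proof -
  obtain B where B: "finite B" "range ((*v) M) \<subseteq> span B" "card B = rank M"
    by (rule rank_spanning_set)
  obtain C where C: "finite C" "range ((*v) N) \<subseteq> span C" "card C = rank N"
    by (rule rank_spanning_set)
  have "(M + N) *v x \<in> span (B \<union> C)" for x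
  proof -
    have "M *v x \<in> span (B \<union> C)" using B(2) span_mono[of B "B \<union> C"] by blast
    moreover have "N *v x \<in> span (B \<union> C)" using C(2) span_mono[of C "B \<union> C"] by blast
    ultimately show ?thesis unfolding matrix_vector_mult_add_rdistrib by (rule span_add)
  qed
  then have "rank (M + N) \<le> card (B \<union> C)"
    by (rule rank_le_card) (use B(1) C(1) in auto)
  also have "\<dots> \<le> rank M + rank N" using card_Un_le[of B C] B C by simp
  finally show ?thesis .
qed

lemma rank_sum_dyad_le:
  assumes "finite I"
  shows "rank (\<Sum>i\<in>I. a i *\<^sub>R dyad (u i) (v i)) \<le> card I"
proof -
  have "rank (\<Sum>i\<in>I. a i *\<^sub>R dyad (u i) (v i)) \<le> card (u ` I)"
  proof (rule rank_le_card)
    show "(\<Sum>i\<in>I. a i *\<^sub>R dyad (u i) (v i)) *v x \<in> span (u ` I)" for x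
      unfolding sum_dyad_mult_vec by (intro span_sum span_mul span_base imageI)
  qed (use assms in simp)
  also have "\<dots> \<le> card I" by (rule card_image_le[OF assms])
  finally show ?thesis .
qed

subsection \<open>Singular value decompositions\<close>

lemma is_svdD:
  fixes X :: "real^'n^'m"
  assumes "is_svd X \<sigma> u v"
  shows "\<And>i. i \<in> {1..CARD('m)} \<Longrightarrow> 0 \<le> \<sigma> i"
    and "\<And>i j. 1 \<le> i \<Longrightarrow> i \<le> j \<Longrightarrow> j \<le> CARD('m) \<Longrightarrow> \<sigma> j \<le> \<sigma> i"
    and "orthonormal_on {1..CARD('m)} u" "orthonormal_on {1..CARD('m)} v"
    and "X = (\<Sum>i=1..CARD('m). \<sigma> i *\<^sub>R dyad (u i) (v i))"
proof -
  note svd = assms[unfolded is_svd_def, folded orthonormal_on_def]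
  show "0 \<le> \<sigma> i" if "i \<in> {1..CARD('m)}" for i
    using svd[THEN conjunct1] that by (rule bspec)
  show "\<sigma> j \<le> \<sigma> i" if "1 \<le> i" "i \<le> j" "j \<le> CARD('m)" for i j
  proof -
    have "i \<in> {1..CARD('m)}" "j \<in> {1..CARD('m)}" using that by simp_all
    then show ?thesis using svd[THEN conjunct2, THEN conjunct1] that(2) by blast
  qed
  show "orthonormal_on {1..CARD('m)} u" using svd by (elim conjE)
  show "orthonormal_on {1..CARD('m)} v" using svd by (elim conjE)
  show "X = (\<Sum>i=1..CARD('m). \<sigma> i *\<^sub>R dyad (u i) (v i))" using svd by (elim conjE)
qed

lemma is_svd_mult_vec:
  fixes X :: "real^'n^'m"
  assumes "is_svd X \<sigma> u v" "i \<in> {1..CARD('m)}"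
  shows "X *v v i = \<sigma> i *\<^sub>R u i"
proof -
  have "X *v v i = (\<Sum>j=1..CARD('m). (\<sigma> j * (v j \<bullet> v i)) *\<^sub>R u j)"
    by (subst is_svdD(5)[OF assms(1)]) (rule sum_dyad_mult_vec)
  also have "\<dots> = (\<Sum>j=1..CARD('m). if j = i then \<sigma> i *\<^sub>R u i else 0)"
    using is_svdD(4)[OF assms(1)] assms(2) by (intro sum.cong) (auto simp: orthonormal_on_def)
  also have "\<dots> = \<sigma> i *\<^sub>R u i" using assms(2) by simp
  finally show ?thesis .
qed

text \<open>The best weights put 1 on the \<open>r\<close> largest values. The threshold
  \<open>s r\<close> separates the indices where \<open>q i - p i\<close> is nonnegative from those
  where it is nonpositive, so replacing \<open>s r\<close> by \<open>s i\<close> can only increase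
  each term \<open>s r * (q i - p i)\<close>.\<close>

lemma sum_weighted_le_sum_largest:
  fixes s p :: "nat \<Rightarrow> real"
  assumes "1 \<le> r" "r \<le> m"
    and mono: "\<And>i j. 1 \<le> i \<Longrightarrow> i \<le> j \<Longrightarrow> j \<le> m \<Longrightarrow> s j \<le> s i"
    and nonneg: "0 \<le> s r"
    and p: "\<And>i. i \<in> {1..m} \<Longrightarrow> 0 \<le> p i" "\<And>i. i \<in> {1..m} \<Longrightarrow> p i \<le> 1" "(\<Sum>i=1..m. p i) \<le> real r"
  shows "(\<Sum>i=1..m. s i * p i) \<le> (\<Sum>i=1..r. s i)"
proof -
  define q where "q i = (if i \<le> r then 1 else 0 :: real)" for i
  have restrict: "(\<Sum>i=1..r. g i) = (\<Sum>i=1..m. g i * q i)" for g :: "nat \<Rightarrow> real"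
    using \<open>r \<le> m\<close> by (intro sum.mono_neutral_cong_left) (auto simp: q_def)
  have "0 \<le> s r * (real r - (\<Sum>i=1..m. p i))" using nonneg p(3) by simp
  also have "\<dots> = (\<Sum>i=1..m. s r * (q i - p i))"
    using restrict[of "\<lambda>_. 1"] by (simp add: sum_subtractf flip: sum_distrib_left)
  also have "\<dots> \<le> (\<Sum>i=1..m. s i * (q i - p i))"
  proof (intro sum_mono)
    fix i assume i: "i \<in> {1..m}"
    show "s r * (q i - p i) \<le> s i * (q i - p i)"
    proof (cases "i \<le> r")
      case True
      then show ?thesis using i p mono[of i r] \<open>r \<le> m\<close>
        by (intro mult_right_mono) (auto simp: q_def)
    next
      case False
      then show ?thesis using i p mono[of r i] \<open>1 \<le> r\<close>
        by (intro mult_right_mono_neg) (auto simp: q_def)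
    qed
  qed
  also have "\<dots> = (\<Sum>i=1..r. s i) - (\<Sum>i=1..m. s i * p i)"
    unfolding restrict[of s] by (simp add: right_diff_distrib sum_subtractf)
  finally show ?thesis by simp
qed

lemma hard_threshold_residual:
  fixes Y :: "real^'n^'m"
  assumes "is_svd Y \<sigma> u v" "r \<le> CARD('m)"
  shows "Y - (\<Sum>i=1..r. \<sigma> i *\<^sub>R dyad (u i) (v i)) = (\<Sum>i=r+1..CARD('m). \<sigma> i *\<^sub>R dyad (u i) (v i))"
proof -
  have "{1..CARD('m)} = {1..r} \<union> {r+1..CARD('m)}" using assms(2) by auto
  then have "(\<Sum>i=1..CARD('m). \<sigma> i *\<^sub>R dyad (u i) (v i))
    = (\<Sum>i=1..r. \<sigma> i *\<^sub>R dyad (u i) (v i)) + (\<Sum>i=r+1..CARD('m). \<sigma> i *\<^sub>R dyad (u i) (v i))"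
    by (simp add: sum.union_disjoint del: One_nat_def)
  then show ?thesis using is_svdD(5)[OF assms(1)] by simp
qed

text \<open>By Pythagoras the left side is the squared distance from \<open>x\<close> to the span;
  what is discarded is the sum of the squared coefficient errors of \<open>w\<close>.\<close>

lemma power2_dist_subspace_ge:
  assumes "orthonormal_on B (\<lambda>b. b)" "finite B" "w \<in> span B"
  shows "(norm x)\<^sup>2 - (\<Sum>b\<in>B. (b \<bullet> x)\<^sup>2) \<le> (norm (x - w))\<^sup>2"
proof -
  obtain a where "w = (\<Sum>b\<in>B. a b *\<^sub>R b)"
    using assms(2,3) by (auto simp: span_finite)
  then show ?thesis
    using power2_dist_orthonormal_sum[OF assms(1,2), of x a]
      sum_nonneg[of B "\<lambda>b. (a b - b \<bullet> x)\<^sup>2"] by simp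
qed

text \<open>Tested on the right singular vectors of \<open>Y\<close>, the distance of \<open>Y\<close> to \<open>W\<close> is at least that of
  the vectors \<open>\<sigma> i *\<^sub>R u i\<close> to the range of \<open>W\<close>.\<close>

theorem eckart_young_frobenius:
  fixes Y Z W :: "real^'n^'m"
  assumes "is_hard_threshold r Y Z" "rank W \<le> r" "1 \<le> r" "r \<le> CARD('m)"
  shows "norm (Y - Z) \<le> norm (Y - W)"
proof -
  obtain \<sigma> u v where svd: "is_svd Y \<sigma> u v"
    and Z: "Z = (\<Sum>i=1..r. \<sigma> i *\<^sub>R dyad (u i) (v i))"
    using assms(1) unfolding is_hard_threshold_def by (elim exE conjE)
  note u = is_svdD(3)[OF svd] and v = is_svdD(4)[OF svd]
  have I: "{1..CARD('m)} = {1..r} \<union> {r+1..CARD('m)}" using assms(4) by auto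
  have sub: "subspace (range ((*v) W))"
    by (intro linear_subspace_image matrix_vector_mul_linear subspace_UNIV)
  obtain B where B: "pairwise orthogonal B" "\<forall>x\<in>B. norm x = 1" "independent B"
    "card B = dim (range ((*v) W))" "span B = range ((*v) W)"
    by (rule orthonormal_basis_subspace[OF sub]) (rule that, assumption, rule ballI, blast, assumption+)
  have orth: "orthonormal_on B (\<lambda>b. b)"
    using B(1,2) by (auto simp: orthonormal_on_def pairwise_def orthogonal_def norm_eq_1)
  have fin: "finite B" using B(3) by (rule finiteI_independent)
  \<comment> \<open>Squared length of the projection of \<open>u i\<close> onto the range of
    \<open>W\<close>. Bessel's inequality for \<open>B\<close> bounds each by 1; Bessel's inequality
    for \<open>u\<close>, after swapping the sums, bounds the total by
    \<open>rank W\<close>.\<close>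
  define p where "p i = (\<Sum>b\<in>B. (b \<bullet> u i)\<^sup>2)" for i
  have p1: "p i \<le> 1" if "i \<in> {1..CARD('m)}" for i
    using bessel_inequality[OF orth fin, of "u i"] norm_orthonormal_on[OF u that] by (simp add: p_def)
  have "(\<Sum>i=1..CARD('m). p i) = (\<Sum>b\<in>B. \<Sum>i=1..CARD('m). (u i \<bullet> b)\<^sup>2)"
    unfolding p_def by (subst sum.swap) (simp add: inner_commute)
  also have "\<dots> \<le> (\<Sum>b\<in>B. (norm b)\<^sup>2)"
    by (intro sum_mono bessel_inequality u) simp
  also have "\<dots> = real (card B)" using B(2) by simp
  also have "\<dots> \<le> real r" using B(4) assms(2) rank_dim_range[of W] by linarith
  finally have psum: "(\<Sum>i=1..CARD('m). p i) \<le> real r" .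
  have le: "(\<Sum>i=1..CARD('m). (\<sigma> i)\<^sup>2 * p i) \<le> (\<Sum>i=1..r. (\<sigma> i)\<^sup>2)"
  proof (rule sum_weighted_le_sum_largest)
    show "(\<sigma> j)\<^sup>2 \<le> (\<sigma> i)\<^sup>2" if "1 \<le> i" "i \<le> j" "j \<le> CARD('m)" for i j
      using that is_svdD(1,2)[OF svd] by (intro power_mono) auto
    show "0 \<le> p i" for i by (simp add: p_def sum_nonneg)
  qed (use assms p1 psum in auto)
  have "(norm (Y - Z))\<^sup>2 = (\<Sum>i=r+1..CARD('m). (\<sigma> i)\<^sup>2)"
    unfolding Z hard_threshold_residual[OF svd assms(4)]
    by (intro norm_orthonormal_sum orthonormal_on_dyad orthonormal_on_subset[OF u] orthonormal_on_subset[OF v]) auto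
  also have "\<dots> = (\<Sum>i=1..CARD('m). (\<sigma> i)\<^sup>2) - (\<Sum>i=1..r. (\<sigma> i)\<^sup>2)"
    unfolding I by (subst sum.union_disjoint) auto
  also have "\<dots> \<le> (\<Sum>i=1..CARD('m). (\<sigma> i)\<^sup>2 - (\<sigma> i)\<^sup>2 * p i)"
    using le by (simp add: sum_subtractf)
  also have "\<dots> \<le> (\<Sum>i=1..CARD('m). (norm ((Y - W) *v v i))\<^sup>2)"
  proof (intro sum_mono)
    fix i assume i: "i \<in> {1..CARD('m)}"
    \<comment> \<open>Here \<open>Y *v v i = \<sigma> i *\<^sub>R u i\<close>, while
      \<open>W *v v i\<close> lies in the span of \<open>B\<close>.\<close>
    have "(norm (\<sigma> i *\<^sub>R u i))\<^sup>2 - (\<Sum>b\<in>B. (b \<bullet> \<sigma> i *\<^sub>R u i)\<^sup>2) \<le> (norm (\<sigma> i *\<^sub>R u i - W *v v i))\<^sup>2"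
      by (rule power2_dist_subspace_ge[OF orth fin]) (simp add: B(5))
    then show "(\<sigma> i)\<^sup>2 - (\<sigma> i)\<^sup>2 * p i \<le> (norm ((Y - W) *v v i))\<^sup>2"
      using norm_orthonormal_on[OF u i] is_svd_mult_vec[OF svd i]
      by (simp add: p_def matrix_vector_mult_diff_rdistrib power_mult_distrib sum_distrib_left)
  qed
  also have "\<dots> \<le> (norm (Y - W))\<^sup>2"
    by (rule norm_ge_orthonormal_mult_vec[OF v]) simp
  finally show ?thesis by (rule power2_le_imp_le) simp
qed

lemma rank_hard_threshold_le:
  assumes "is_hard_threshold r Y Z"
  shows "rank Z \<le> r"
proof -
  obtain \<sigma> u v where Z: "Z = (\<Sum>i=1..r. \<sigma> i *\<^sub>R dyad (u i) (v i))"
    using assms unfolding is_hard_threshold_def by (elim exE conjE)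
  show ?thesis unfolding Z using rank_sum_dyad_le[of "{1..r}" \<sigma> u v] by simp
qed

text \<open>Every \<open>u i\<close> that survives with a positive coefficient is the image of
  \<open>v i / \<sigma> i\<close> under \<open>Z\<close>, so the range does not grow.\<close>

lemma rank_shrinkage_le:
  fixes Z Z' :: "real^'n^'m"
  assumes "is_shrinkage \<nu> Z Z'" "0 \<le> \<nu>"
  shows "rank Z' \<le> rank Z"
proof -
  obtain \<sigma> u v where svd: "is_svd Z \<sigma> u v"
    and Z': "Z' = (\<Sum>i=1..CARD('m). max (\<sigma> i - \<nu>) 0 *\<^sub>R dyad (u i) (v i))"
    using assms(1) unfolding is_shrinkage_def by (elim exE conjE)
  show ?thesis
  proof (rule rank_le_rank)
    fix x
    have "Z' *v x = (\<Sum>i=1..CARD('m). (max (\<sigma> i - \<nu>) 0 * (v i \<bullet> x)) *\<^sub>R u i)"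
      unfolding Z' sum_dyad_mult_vec ..
    \<comment> \<open>Where \<open>\<sigma> i = 0\<close> the shrunken value is 0 as well because
      \<open>0 \<le> \<nu>\<close>, so both sides vanish and the division by zero is
      harmless.\<close>
    also have "\<dots> = (\<Sum>i=1..CARD('m). Z *v ((max (\<sigma> i - \<nu>) 0 * (v i \<bullet> x) / \<sigma> i) *\<^sub>R v i))"
    proof (intro sum.cong refl)
      fix i assume "i \<in> {1..CARD('m)}"
      then have "Z *v v i = \<sigma> i *\<^sub>R u i" by (rule is_svd_mult_vec[OF svd])
      then show "(max (\<sigma> i - \<nu>) 0 * (v i \<bullet> x)) *\<^sub>R u i
          = Z *v ((max (\<sigma> i - \<nu>) 0 * (v i \<bullet> x) / \<sigma> i) *\<^sub>R v i)"
        using assms(2) by (cases "\<sigma> i = 0") (simp_all add: matrix_vector_mult_scaleR)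
    qed
    also have "\<dots> = Z *v (\<Sum>i=1..CARD('m). (max (\<sigma> i - \<nu>) 0 * (v i \<bullet> x) / \<sigma> i) *\<^sub>R v i)"
      by (simp add: linear_sum[OF matrix_vector_mul_linear])
    finally show "Z' *v x \<in> range ((*v) Z)" by blast
  qed
qed

text \<open>Shrinking removes \<open>min (\<sigma> i) \<nu>\<close> from each of the
  \<open>CARD('m)\<close> singular values, hence at most \<open>\<nu>\<close> along each of as many
  orthonormal dyads.\<close>

lemma norm_shrinkage_diff_le:
  fixes Z Z' :: "real^'n^'m"
  assumes "is_shrinkage \<nu> Z Z'" "0 \<le> \<nu>"
  shows "norm (Z - Z') \<le> sqrt (real CARD('m)) * \<nu>"
proof -
  obtain \<sigma> u v where svd: "is_svd Z \<sigma> u v"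
    and Z': "Z' = (\<Sum>i=1..CARD('m). max (\<sigma> i - \<nu>) 0 *\<^sub>R dyad (u i) (v i))"
    using assms(1) unfolding is_shrinkage_def by (elim exE conjE)
  have "Z - Z' = (\<Sum>i=1..CARD('m). min (\<sigma> i) \<nu> *\<^sub>R dyad (u i) (v i))"
    unfolding is_svdD(5)[OF svd] Z' sum_subtractf[symmetric] scaleR_diff_left[symmetric]
    by (intro sum.cong) auto
  then have "(norm (Z - Z'))\<^sup>2 = (\<Sum>i=1..CARD('m). (min (\<sigma> i) \<nu>)\<^sup>2)"
    using is_svdD(3,4)[OF svd] by (simp add: norm_orthonormal_sum orthonormal_on_dyad)
  also have "\<dots> \<le> (\<Sum>i=1..CARD('m). \<nu>\<^sup>2)"
    using is_svdD(1)[OF svd] assms(2) by (intro sum_mono power_mono) auto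
  also have "\<dots> = (sqrt (real CARD('m)) * \<nu>)\<^sup>2" by (simp add: power_mult_distrib)
  finally show ?thesis by (rule power2_le_imp_le) (use assms(2) in simp)
qed

subsection \<open>The nuclear norm\<close>

text \<open>Duality: pair \<open>M\<close> with the partial isometry that sends each \<open>v i\<close> to \<open>u i\<close>.\<close>

lemma sum_singular_values_le:
  fixes M :: "real^'n^'m"
  assumes svd: "is_svd M \<sigma> u v" and svd': "is_svd M \<tau> w z"
  shows "(\<Sum>i=1..CARD('m). \<sigma> i) \<le> (\<Sum>i=1..CARD('m). \<tau> i)"
proof -
  note u = is_svdD(3)[OF svd] and v = is_svdD(4)[OF svd]
  define Q where "Q = (\<Sum>i=1..CARD('m). 1 *\<^sub>R dyad (u i) (v i))"
  have Q_contraction: "norm (Q *v x) \<le> norm x" for x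
  proof (rule power2_le_imp_le)
    have "(norm (Q *v x))\<^sup>2 = (\<Sum>i=1..CARD('m). (1 * (v i \<bullet> x))\<^sup>2)"
      unfolding Q_def sum_dyad_mult_vec by (rule norm_orthonormal_sum[OF u]) simp
    also have "\<dots> \<le> (norm x)\<^sup>2" using bessel_inequality[OF v, of x] by simp
    finally show "(norm (Q *v x))\<^sup>2 \<le> (norm x)\<^sup>2" .
  qed simp
  have "M \<bullet> Q = (\<Sum>i=1..CARD('m). u i \<bullet> (M *v v i))"
    unfolding Q_def inner_sum_right scaleR_one inner_dyad ..
  also have "\<dots> = (\<Sum>i=1..CARD('m). \<sigma> i)"
  proof (intro sum.cong refl)
    fix i assume i: "i \<in> {1..CARD('m)}"
    then have "u i \<bullet> u i = 1" using norm_orthonormal_on[OF u i] by (simp add: norm_eq_1)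
    then show "u i \<bullet> (M *v v i) = \<sigma> i" unfolding is_svd_mult_vec[OF svd i] by simp
  qed
  finally have "(\<Sum>i=1..CARD('m). \<sigma> i) = Q \<bullet> M" by (simp only: inner_commute)
  also have "\<dots> = (\<Sum>i=1..CARD('m). \<tau> i * (w i \<bullet> (Q *v z i)))"
    by (subst is_svdD(5)[OF svd']) (simp only: inner_sum_right inner_scaleR_right inner_dyad)
  also have "\<dots> \<le> (\<Sum>i=1..CARD('m). \<tau> i * 1)"
  proof (intro sum_mono mult_left_mono)
    fix i assume i: "i \<in> {1..CARD('m)}"
    show "0 \<le> \<tau> i" by (rule is_svdD(1)[OF svd' i])
    have "w i \<bullet> (Q *v z i) \<le> norm (w i) * norm (Q *v z i)" by (rule norm_cauchy_schwarz)
    also have "\<dots> \<le> 1"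
      using norm_orthonormal_on[OF is_svdD(3)[OF svd'] i] norm_orthonormal_on[OF is_svdD(4)[OF svd'] i]
        Q_contraction[of "z i"] by simp
    finally show "w i \<bullet> (Q *v z i) \<le> 1" .
  qed
  finally show ?thesis by simp
qed

text \<open>The preceding inequality, used in both directions, makes the definite description
  unique.\<close>

lemma nuclear_norm_eq:
  fixes M :: "real^'n^'m"
  assumes "is_svd M \<sigma> u v"
  shows "nuclear_norm M = (\<Sum>i=1..CARD('m). \<sigma> i)"
  unfolding nuclear_norm_def
proof (rule the_equality)
  show "\<exists>\<tau> w z. is_svd M \<tau> w z \<and> (\<Sum>i=1..CARD('m). \<sigma> i) = (\<Sum>i=1..CARD('m). \<tau> i)"
    by (intro exI conjI, rule assms, rule refl)
next
  fix s assume "\<exists>\<tau> w z. is_svd M \<tau> w z \<and> s = (\<Sum>i=1..CARD('m). \<tau> i)"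
  then obtain \<tau> w z where svd': "is_svd M \<tau> w z" and s: "s = (\<Sum>i=1..CARD('m). \<tau> i)"
    by (elim exE conjE)
  show "s = (\<Sum>i=1..CARD('m). \<sigma> i)"
    unfolding s using sum_singular_values_le[OF assms svd'] sum_singular_values_le[OF svd' assms]
    by (rule order_antisym[rotated])
qed

text \<open>Makes the nuclear norm of the residual computable: the discarded singular values move to
  the front and zeros fill up the rest.\<close>

lemma hard_threshold_residual_is_svd:
  fixes Y Z :: "real^'n^'m"
  assumes "is_hard_threshold r Y Z" "r \<le> CARD('m)"
  obtains \<sigma> u v where "is_svd (Y - Z) \<sigma> u v"
proof -
  obtain \<sigma> u v where svd: "is_svd Y \<sigma> u v"
    and Z: "Z = (\<Sum>i=1..r. \<sigma> i *\<^sub>R dyad (u i) (v i))"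
    using assms(1) unfolding is_hard_threshold_def by (elim exE conjE)
  note D = is_svdD[OF svd]
  define k where "k = CARD('m) - r"
  have k: "k + r = CARD('m)" using assms(2) by (simp add: k_def)
  \<comment> \<open>A cyclic shift by \<open>r\<close>: the first \<open>r\<close> singular vectors
    go to the end, where they accompany the zero singular values.\<close>
  define p where "p i = (if i \<le> k then i + r else i - k)" for i
  define \<tau> where "\<tau> i = (if i \<le> k then \<sigma> (i + r) else 0)" for i
  have inj: "inj_on p {1..CARD('m)}"
    unfolding inj_on_def p_def k[symmetric] by auto
  have img: "p ` {1..CARD('m)} \<subseteq> {1..CARD('m)}"
    unfolding p_def k[symmetric] by auto
  have "Y - Z = (\<Sum>i=1+r..k+r. \<sigma> i *\<^sub>R dyad (u i) (v i))"
    unfolding Z hard_threshold_residual[OF svd assms(2)] k by (simp add: add.commute)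
  also have "\<dots> = (\<Sum>i=1..k. \<sigma> (i + r) *\<^sub>R dyad (u (i + r)) (v (i + r)))"
    by (rule sum.shift_bounds_cl_nat_ivl)
  also have "\<dots> = (\<Sum>i=1..CARD('m). \<tau> i *\<^sub>R dyad (u (p i)) (v (p i)))"
    by (rule sum.mono_neutral_cong_left) (auto simp: \<tau>_def p_def k[symmetric])
  finally have YZ: "Y - Z = (\<Sum>i=1..CARD('m). \<tau> i *\<^sub>R dyad (u (p i)) (v (p i)))" .
  have "is_svd (Y - Z) \<tau> (\<lambda>i. u (p i)) (\<lambda>i. v (p i))"
    unfolding is_svd_def
  proof (intro conjI)
    show "\<forall>i\<in>{1..CARD('m)}. 0 \<le> \<tau> i"
      using D(1) by (simp add: \<tau>_def k[symmetric])
    show "\<forall>i\<in>{1..CARD('m)}. \<forall>j\<in>{1..CARD('m)}. i \<le> j \<longrightarrow> \<tau> j \<le> \<tau> i"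
      using D(1,2) by (simp add: \<tau>_def k[symmetric])
    show "\<forall>i\<in>{1..CARD('m)}. \<forall>j\<in>{1..CARD('m)}. u (p i) \<bullet> u (p j) = (if i = j then 1 else 0)"
      by (rule orthonormal_on_reindex[OF D(3) inj img, unfolded orthonormal_on_def])
    show "\<forall>i\<in>{1..CARD('m)}. \<forall>j\<in>{1..CARD('m)}. v (p i) \<bullet> v (p j) = (if i = j then 1 else 0)"
      by (rule orthonormal_on_reindex[OF D(4) inj img, unfolded orthonormal_on_def])
  qed (rule YZ)
  then show ?thesis by (rule that)
qed

text \<open>The singular values are cut into consecutive blocks of length \<open>r\<close>: the Frobenius norm of a block
  is at most \<open>1 / sqrt r\<close> times the sum of the singular values in the block before it.\<close>

lemma norm_image_le_frobenius_nuclear: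
  fixes A :: "real^'n^'m \<Rightarrow> real^'p" and M :: "real^'n^'m"
  assumes "linear A" and c: "\<And>X. rank X \<le> r \<Longrightarrow> norm (A X) \<le> c * norm X" and "0 \<le> c"
    and r: "1 \<le> r" "r \<le> CARD('m)" and svd: "is_svd M \<sigma> u v"
  shows "norm (A M) \<le> c * (norm M + 1 / sqrt (real r) * nuclear_norm M)"
proof -
  let ?m = "CARD('m)"
  note D = is_svdD[OF svd]
  define f where "f i = dyad (u i) (v i)" for i
  \<comment> \<open>Extension by zero, so that the last block may run past index
    \<open>CARD('m)\<close>.\<close>
  define s where "s i = (if i \<le> ?m then \<sigma> i else 0)" for i
  have s_nonneg: "0 \<le> s i" if "1 \<le> i" for i using D(1) that by (simp add: s_def)
  have s_mono: "s j \<le> s i" if "1 \<le> i" "i \<le> j" for i j using D(1,2) that by (simp add: s_def)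
  have f: "orthonormal_on {1..?m} f" unfolding f_def by (rule orthonormal_on_dyad[OF D(3,4)])
  have norm_f: "(norm (\<Sum>i\<in>I. s i *\<^sub>R f i))\<^sup>2 = (\<Sum>i\<in>I. (s i)\<^sup>2)"
    if "finite I" "I \<subseteq> {1..}" for I
  proof -
    have "(\<Sum>i\<in>I. s i *\<^sub>R f i) = (\<Sum>i\<in>I \<inter> {1..?m}. s i *\<^sub>R f i)"
      using that by (intro sum.mono_neutral_right) (auto simp: s_def)
    moreover have "(\<Sum>i\<in>I. (s i)\<^sup>2) = (\<Sum>i\<in>I \<inter> {1..?m}. (s i)\<^sup>2)"
      using that by (intro sum.mono_neutral_right) (auto simp: s_def)
    ultimately show ?thesis
      using norm_orthonormal_sum[OF orthonormal_on_subset[OF f, of "I \<inter> {1..?m}"]] by simp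
  qed
  have block: "norm (A (\<Sum>i\<in>I. s i *\<^sub>R f i)) \<le> c * norm (\<Sum>i\<in>I. s i *\<^sub>R f i)"
    if "finite I" "card I \<le> r" for I
    using rank_sum_dyad_le[OF that(1), of s u v] that(2) by (intro c) (simp add: f_def)
  \<comment> \<open>By monotonicity \<open>s (k + r)\<close> is at most each of the \<open>r\<close>
    values before it, hence at most their mean.\<close>
  have block_le: "sqrt r * s (k + r) \<le> 1 / sqrt r * (\<Sum>i=k..<k+r. s i)" if "1 \<le> k" for k
  proof -
    have "real r * s (k + r) = (\<Sum>i=k..<k+r. s (k + r))" by simp
    also have "\<dots> \<le> (\<Sum>i=k..<k+r. s i)" using that by (intro sum_mono s_mono) auto
    finally have "real r * s (k + r) / sqrt r \<le> (\<Sum>i=k..<k+r. s i) / sqrt r"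
      by (rule divide_right_mono) simp
    moreover have "real r * s (k + r) / sqrt r = sqrt r * s (k + r)"
      by (metis real_div_sqrt of_nat_0_le_iff times_divide_eq_left)
    ultimately show ?thesis by simp
  qed
  \<comment> \<open>Large enough that a block starting at any \<open>k \<le> ?m\<close> ends within
    the range of summation.\<close>
  define N where "N = ?m + 1 + r"
  have split: "A (\<Sum>i=k..<N. s i *\<^sub>R f i)
      = A (\<Sum>i=k..<k+r. s i *\<^sub>R f i) + A (\<Sum>i=k+r..<N. s i *\<^sub>R f i)"
    and split': "(\<Sum>i=k..<N. s i) = (\<Sum>i=k..<k+r. s i) + (\<Sum>i=k+r..<N. s i)" if "k + r \<le> N" for k
    using that by (simp_all add: sum.atLeastLessThan_concat flip: linear_add[OF \<open>linear A\<close>])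
  \<comment> \<open>The block starting at \<open>k\<close> is paid for by the separate term with
    \<open>s k\<close>; every later block is charged to its predecessor through
    \<open>block_le\<close>. The induction advances \<open>k\<close> by \<open>r\<close>, until all
    values are zero.\<close>
  have bound: "norm (A (\<Sum>i=k..<N. s i *\<^sub>R f i))
      \<le> c * (sqrt r * s k + 1 / sqrt r * (\<Sum>i=k..<N. s i))" if "1 \<le> k" for k
    using that
  proof (induction "N - k" arbitrary: k rule: less_induct)
    case less
    show ?case
    proof (cases "k \<le> ?m")
      case False
      then have "(\<Sum>i=k..<N. s i *\<^sub>R f i) = 0" by (intro sum.neutral) (simp add: s_def)
      moreover have "0 \<le> (\<Sum>i=k..<N. s i)" using less.prems by (intro sum_nonneg s_nonneg) simp
      ultimately show ?thesis
        using s_nonneg[OF less.prems] \<open>0 \<le> c\<close> by (simp add: linear_0[OF \<open>linear A\<close>])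
    next
      case True
      then have kN: "k + r \<le> N" "N - (k + r) < N - k" using r by (auto simp: N_def)
      have "(norm (\<Sum>i=k..<k+r. s i *\<^sub>R f i))\<^sup>2 = (\<Sum>i=k..<k+r. (s i)\<^sup>2)"
        using less.prems by (intro norm_f) auto
      also have "\<dots> \<le> (\<Sum>i=k..<k+r. (s k)\<^sup>2)"
        using less.prems by (intro sum_mono power_mono s_mono s_nonneg) auto
      also have "\<dots> = (sqrt r * s k)\<^sup>2" by (simp add: power_mult_distrib)
      finally have "norm (\<Sum>i=k..<k+r. s i *\<^sub>R f i) \<le> sqrt r * s k"
        by (rule power2_le_imp_le) (use s_nonneg less.prems in simp)
      then have first: "norm (A (\<Sum>i=k..<k+r. s i *\<^sub>R f i)) \<le> c * (sqrt r * s k)"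
        using block[of "{k..<k+r}"] mult_left_mono[OF _ \<open>0 \<le> c\<close>] by fastforce
      have "norm (A (\<Sum>i=k+r..<N. s i *\<^sub>R f i))
          \<le> c * (sqrt r * s (k + r) + 1 / sqrt r * (\<Sum>i=k+r..<N. s i))"
        using less.prems by (intro less.hyps kN(2)) simp
      also have "\<dots> \<le> c * (1 / sqrt r * (\<Sum>i=k..<N. s i))"
        unfolding split'[OF kN(1)]
        using block_le[OF less.prems] \<open>0 \<le> c\<close>
        by (intro mult_left_mono) (simp_all add: distrib_left)
      finally show ?thesis
        unfolding split[OF kN(1)] using first norm_triangle_ineq
        by (smt (verit) distrib_left)
    qed
  qed
  have "M = (\<Sum>i=1..?m. s i *\<^sub>R f i)"
    by (subst D(5)) (simp add: s_def f_def)
  also have "\<dots> = (\<Sum>i=1..<N. s i *\<^sub>R f i)"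
    by (intro sum.mono_neutral_left) (auto simp: N_def s_def)
  finally have M: "M = (\<Sum>i=1..<N. s i *\<^sub>R f i)" .
  have "nuclear_norm M = (\<Sum>i=1..?m. s i)"
    unfolding nuclear_norm_eq[OF svd] by (simp add: s_def)
  also have "\<dots> = (\<Sum>i=1..<N. s i)"
    by (intro sum.mono_neutral_left) (auto simp: N_def s_def)
  finally have nuc: "nuclear_norm M = (\<Sum>i=1..<N. s i)" .
  have N: "1 + r \<le> N" by (simp add: N_def)
  \<comment> \<open>The first block has no predecessor to be charged to; it accounts for the
    Frobenius term of the bound.\<close>
  have "norm (\<Sum>i=1..<1+r. s i *\<^sub>R f i) \<le> norm M"
  proof (rule power2_le_imp_le)
    have "(norm (\<Sum>i=1..<1+r. s i *\<^sub>R f i))\<^sup>2 = (\<Sum>i=1..<1+r. (s i)\<^sup>2)"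
      by (rule norm_f) auto
    also have "\<dots> \<le> (\<Sum>i=1..<N. (s i)\<^sup>2)"
      using N by (intro sum_mono2) auto
    also have "\<dots> = (norm M)\<^sup>2"
      unfolding M by (rule norm_f[symmetric]) auto
    finally show "(norm (\<Sum>i=1..<1+r. s i *\<^sub>R f i))\<^sup>2 \<le> (norm M)\<^sup>2" .
  qed simp
  then have "c * norm (\<Sum>i=1..<1+r. s i *\<^sub>R f i) \<le> c * norm M"
    by (rule mult_left_mono) (rule \<open>0 \<le> c\<close>)
  with block[of "{1..<1+r}"] have first: "norm (A (\<Sum>i=1..<1+r. s i *\<^sub>R f i)) \<le> c * norm M"
    by simp
  have "norm (A (\<Sum>i=1+r..<N. s i *\<^sub>R f i))
      \<le> c * (sqrt r * s (1 + r) + 1 / sqrt r * (\<Sum>i=1+r..<N. s i))"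
    by (rule bound) simp
  also have "\<dots> \<le> c * (1 / sqrt r * nuclear_norm M)"
    unfolding nuc split'[OF N] using block_le[of 1] \<open>0 \<le> c\<close>
    by (intro mult_left_mono) (simp_all add: distrib_left)
  finally have rest: "norm (A (\<Sum>i=1+r..<N. s i *\<^sub>R f i)) \<le> c * (1 / sqrt r * nuclear_norm M)" .
  have "A M = A (\<Sum>i=1..<1+r. s i *\<^sub>R f i) + A (\<Sum>i=1+r..<N. s i *\<^sub>R f i)"
    by (subst M) (rule split[OF N])
  then have "norm (A M) \<le> norm (A (\<Sum>i=1..<1+r. s i *\<^sub>R f i)) + norm (A (\<Sum>i=1+r..<N. s i *\<^sub>R f i))"
    by (simp only: norm_triangle_ineq)
  with first rest show ?thesis unfolding distrib_left by linarith
qed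

subsection \<open>Restricted isometry\<close>

text \<open>A \<open>LEAST\<close> over the reals carries information only if the minimum is
  attained. The admissible constants are those above a family of quotients; they are nonempty and
  bounded below, so their infimum is admissible and equals \<open>ric A s\<close>. Any larger
  constant is admissible too.\<close>

lemma ric_bounds:
  fixes A :: "real^'n^'m \<Rightarrow> real^'p"
  assumes "linear A" "1 \<le> s" "rank X \<le> s" and le: "ric A s \<le> \<delta>"
  shows "(1 - \<delta>) * (norm X)\<^sup>2 \<le> (norm (A X))\<^sup>2" and "(norm (A X))\<^sup>2 \<le> (1 + \<delta>) * (norm X)\<^sup>2"
proof -
  define P where "P \<delta> \<longleftrightarrow> (\<forall>X. rank X \<le> s \<longrightarrow>
     (1 - \<delta>) * (norm X)\<^sup>2 \<le> (norm (A X))\<^sup>2 \<and> (norm (A X))\<^sup>2 \<le> (1 + \<delta>) * (norm X)\<^sup>2)" for \<delta>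
  \<comment> \<open>Dividing by \<open>(norm X)\<^sup>2\<close> turns each condition into a lower
    bound on \<delta>, a form that passes to the infimum.\<close>
  have P_iff: "P \<delta> \<longleftrightarrow> (\<forall>X. rank X \<le> s \<and> X \<noteq> 0 \<longrightarrow>
     1 - (norm (A X))\<^sup>2 / (norm X)\<^sup>2 \<le> \<delta> \<and> (norm (A X))\<^sup>2 / (norm X)\<^sup>2 - 1 \<le> \<delta>)" for \<delta>
  proof -
    have "(1 - \<delta>) * (norm X)\<^sup>2 \<le> (norm (A X))\<^sup>2 \<and> (norm (A X))\<^sup>2 \<le> (1 + \<delta>) * (norm X)\<^sup>2
      \<longleftrightarrow> (X \<noteq> 0 \<longrightarrow> 1 - (norm (A X))\<^sup>2 / (norm X)\<^sup>2 \<le> \<delta> \<and> (norm (A X))\<^sup>2 / (norm X)\<^sup>2 - 1 \<le> \<delta>)"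
      for X
    proof (cases "X = 0")
      case False
      then have "0 < (norm X)\<^sup>2" by simp
      then show ?thesis using False by (simp add: field_simps)
    qed (simp add: linear_0[OF \<open>linear A\<close>])
    then show ?thesis unfolding P_def by (simp add: imp_conjL)
  qed
  obtain B where B: "\<forall>x. norm (A x) \<le> B * norm x"
    using linear_bounded[OF \<open>linear A\<close>] by (elim exE)
  have "P (1 + B\<^sup>2)"
    unfolding P_def
  proof (intro allI impI conjI)
    fix X :: "real^'n^'m"
    have "(1 - (1 + B\<^sup>2)) * (norm X)\<^sup>2 \<le> 0" by (simp add: mult_nonpos_nonneg)
    then show "(1 - (1 + B\<^sup>2)) * (norm X)\<^sup>2 \<le> (norm (A X))\<^sup>2"
      by (rule order_trans) simp
    have "(norm (A X))\<^sup>2 \<le> (B * norm X)\<^sup>2" by (rule power_mono[OF spec[OF B]]) simp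
    also have "\<dots> \<le> (1 + (1 + B\<^sup>2)) * (norm X)\<^sup>2"
      unfolding power_mult_distrib by (rule mult_right_mono) simp_all
    finally show "(norm (A X))\<^sup>2 \<le> (1 + (1 + B\<^sup>2)) * (norm X)\<^sup>2" .
  qed
  then have nonempty: "{\<delta>. P \<delta>} \<noteq> {}" by blast
  obtain a :: 'm and b :: 'n where True by simp
  let ?E = "dyad (axis a 1) (axis b 1) :: real^'n^'m"
  have "rank ?E \<le> s" using rank_sum_dyad_le[of "{()}" "\<lambda>_. 1" "\<lambda>_. axis a 1" "\<lambda>_. axis b 1"] \<open>1 \<le> s\<close>
    by simp
  moreover have "?E \<noteq> 0"
  proof
    assume "?E = 0"
    then have "?E $ a $ b = 0" by simp
    then show False unfolding dyad_nth by simp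
  qed
  ultimately have P_ge: "1 - (norm (A ?E))\<^sup>2 / (norm ?E)\<^sup>2 \<le> \<delta>" if "P \<delta>" for \<delta>
    using that unfolding P_iff by simp
  then have bdd: "bdd_below {\<delta>. P \<delta>}" by (intro bdd_belowI) simp
  have "P (Inf {\<delta>. P \<delta>})"
    by (intro P_iff[THEN iffD2] allI impI conjI; rule cInf_greatest[OF nonempty]) (simp_all add: P_iff)
  moreover have "ric A s = (LEAST \<delta>. P \<delta>)"
    unfolding ric_def P_def ..
  moreover have "(LEAST \<delta>. P \<delta>) = Inf {\<delta>. P \<delta>}"
    using calculation(1) by (rule Least_equality) (simp add: cInf_lower bdd)
  ultimately have "P (ric A s)" by simp
  then have "P \<delta>" unfolding P_iff using le by force
  then show "(1 - \<delta>) * (norm X)\<^sup>2 \<le> (norm (A X))\<^sup>2" "(norm (A X))\<^sup>2 \<le> (1 + \<delta>) * (norm X)\<^sup>2"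
    unfolding P_def using assms(3) by simp_all
qed

text \<open>With \<open>D\<close> and \<open>W\<close> scaled to unit length, apply the lower bound
  to their sum and the upper bound to their difference. Subtracting cancels the squared norms of the
  two images and leaves the inner products.\<close>

lemma polarized_restricted_isometry:
  fixes A :: "'a::real_inner \<Rightarrow> 'b::real_inner"
  assumes "linear A"
    and "\<And>a b. (1 - \<delta>) * (norm (a *\<^sub>R D + b *\<^sub>R W))\<^sup>2 \<le> (norm (A (a *\<^sub>R D + b *\<^sub>R W)))\<^sup>2"
    and "\<And>a b. (norm (A (a *\<^sub>R D + b *\<^sub>R W)))\<^sup>2 \<le> (1 + \<delta>) * (norm (a *\<^sub>R D + b *\<^sub>R W))\<^sup>2"
  shows "D \<bullet> W - A D \<bullet> A W \<le> \<delta> * (norm D * norm W)"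
proof (cases "D = 0 \<or> W = 0")
  case True
  then show ?thesis using linear_0[OF assms(1)] by auto
next
  case False
  \<comment> \<open>Normalisation yields the product \<open>norm D * norm W\<close> instead of a
    mean of squares.\<close>
  define a b where "a = inverse (norm D)" and "b = inverse (norm W)"
  have ab: "0 < a * b" using False by (simp add: a_def b_def)
  have expand: "(norm (x + y))\<^sup>2 = (norm x)\<^sup>2 + (norm y)\<^sup>2 + 2 * (x \<bullet> y)" for x y :: "'c::real_inner"
    by (simp add: power2_norm_eq_inner inner_add_left inner_add_right inner_commute)
  have 1: "(norm (a *\<^sub>R D + (t * b) *\<^sub>R W))\<^sup>2 = 1 + 1 + 2 * t * (a * b * (D \<bullet> W))" if "\<bar>t\<bar> = 1" for t
    unfolding expand using False that by (simp add: a_def b_def power_mult_distrib abs_mult)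
  have 2: "(norm (A (a *\<^sub>R D + (t * b) *\<^sub>R W)))\<^sup>2
      = (norm (a *\<^sub>R A D))\<^sup>2 + (norm (b *\<^sub>R A W))\<^sup>2 + 2 * t * (a * b * (A D \<bullet> A W))" if "\<bar>t\<bar> = 1" for t
    unfolding linear_add[OF assms(1)] linear_scale[OF assms(1)] expand
    using that by (simp add: abs_mult)
  define k l c where "k = a * b * (D \<bullet> W)" and "l = a * b * (A D \<bullet> A W)"
    and "c = (norm (a *\<^sub>R A D))\<^sup>2 + (norm (b *\<^sub>R A W))\<^sup>2"
  have "(1 - \<delta>) * (2 + 2 * k) \<le> c + 2 * l"
    using assms(2)[of a "1 * b"] unfolding 1[of 1, OF abs_one] 2[of 1, OF abs_one] k_def l_def c_def by simp
  moreover have "c - 2 * l \<le> (1 + \<delta>) * (2 - 2 * k)"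
    using assms(3)[of a "-1 * b"] 1[of "-1"] 2[of "-1"] unfolding k_def l_def c_def by simp
  ultimately have "k - l \<le> \<delta>" by (simp add: algebra_simps)
  then have "a * b * (D \<bullet> W - A D \<bullet> A W) \<le> \<delta>" by (simp add: k_def l_def right_diff_distrib)
  then have "D \<bullet> W - A D \<bullet> A W \<le> \<delta> / (a * b)" using ab by (simp only: pos_le_divide_eq mult.commute)
  then show ?thesis by (simp add: a_def b_def divide_inverse)
qed

subsection \<open>Convergence of FPCAr\<close>

text \<open>Here \<open>X\<close> is the current iterate and \<open>e\<close> the noise relative to
  \<open>Xr\<close>, so that the image of the tail of the unknown matrix counts as noise.\<close>

lemma fpcar_step_error:
  fixes A :: "real^'n^'m \<Rightarrow> real^'p" and X Xr :: "real^'n^'m"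
  assumes "linear A"
    and rip: "\<And>X. rank X \<le> 3 * r \<Longrightarrow> (1 - \<delta>) * (norm X)\<^sup>2 \<le> (norm (A X))\<^sup>2"
      "\<And>X. rank X \<le> 3 * r \<Longrightarrow> (norm (A X))\<^sup>2 \<le> (1 + \<delta>) * (norm X)\<^sup>2"
    and "0 \<le> \<delta>" and b: "b = A Xr + e" and rank: "rank Xr \<le> r" "rank X \<le> r"
    and r: "1 \<le> r" "r \<le> CARD('m)" and step: "fpcar_step A b r \<mu> X X'" and "0 \<le> \<mu>"
  shows "rank X' \<le> r"
    and "norm (X' - Xr) \<le> 2 * \<delta> * norm (X - Xr) + 2 * sqrt (1 + \<delta>) * norm e + sqrt (real CARD('m)) * \<mu>"
proof -
  obtain Y Z where Y: "Y = X - adjoint A (A X - b)" and Z: "is_hard_threshold r Y Z"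
    and X': "is_shrinkage \<mu> Z X'"
    using step unfolding fpcar_step_def by (elim exE conjE)
  have rank_Z: "rank Z \<le> r" by (rule rank_hard_threshold_le[OF Z])
  then show "rank X' \<le> r" using rank_shrinkage_le[OF X' \<open>0 \<le> \<mu>\<close>] by linarith
  define D W G where "D = Z - Xr" and "W = X - Xr" and "G = Y - Xr"
  \<comment> \<open>Both differences subtract the same \<open>Xr\<close>; merging the two copies
    leaves three matrices of rank at most \<open>r\<close>, which is where \<open>3 * r\<close>
    comes from.\<close>
  have rank_comb: "rank (s *\<^sub>R D + t *\<^sub>R W) \<le> 3 * r" for s t
  proof -
    have "s *\<^sub>R D + t *\<^sub>R W = s *\<^sub>R Z + t *\<^sub>R X + (- (s + t)) *\<^sub>R Xr"
      by (simp add: D_def W_def algebra_simps)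
    then have "rank (s *\<^sub>R D + t *\<^sub>R W) = rank (s *\<^sub>R Z + t *\<^sub>R X + (- (s + t)) *\<^sub>R Xr)"
      by (rule arg_cong)
    then show ?thesis
      using rank_add_le[of "s *\<^sub>R Z + t *\<^sub>R X" "(- (s + t)) *\<^sub>R Xr"] rank_add_le[of "s *\<^sub>R Z" "t *\<^sub>R X"]
        rank_scaleR_le[of s Z] rank_scaleR_le[of t X] rank_scaleR_le[of "- (s + t)" Xr] rank rank_Z
      by linarith
  qed
  have "norm (G - D) \<le> norm G"
    using eckart_young_frobenius[OF Z rank(1) r] by (simp add: G_def D_def)
  then have "(norm (G - D))\<^sup>2 \<le> (norm G)\<^sup>2" by (rule power_mono) simp
  \<comment> \<open>Expanding the left square cancels \<open>(norm G)\<^sup>2\<close>.\<close>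
  then have "(norm D)\<^sup>2 \<le> 2 * (D \<bullet> G)"
    by (simp add: power2_norm_eq_inner inner_diff_left inner_diff_right inner_commute)
  also have "D \<bullet> G = D \<bullet> W - A D \<bullet> A W + A D \<bullet> e"
  proof -
    have "G = W - adjoint A (A X - b)" by (simp add: G_def W_def Y)
    moreover have "A X - b = A W - e" by (simp add: b W_def linear_diff[OF \<open>linear A\<close>])
    ultimately show ?thesis
      by (simp add: inner_diff_right adjoint_works[OF \<open>linear A\<close>])
  qed
  also have "D \<bullet> W - A D \<bullet> A W \<le> \<delta> * (norm D * norm W)"
    by (rule polarized_restricted_isometry[OF \<open>linear A\<close> rip]) (rule rank_comb)+
  also have "A D \<bullet> e \<le> sqrt (1 + \<delta>) * norm D * norm e"
  proof -
    have "(norm (A D))\<^sup>2 \<le> (sqrt (1 + \<delta>) * norm D)\<^sup>2"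
      using rip(2)[OF rank_comb[of 1 0]] \<open>0 \<le> \<delta>\<close> by (simp add: power_mult_distrib)
    then have "norm (A D) \<le> sqrt (1 + \<delta>) * norm D"
      by (rule power2_le_imp_le) (use \<open>0 \<le> \<delta>\<close> in simp)
    then show ?thesis
      using norm_cauchy_schwarz[of "A D" e] mult_right_mono[of "norm (A D)" _ "norm e"]
      by (meson norm_ge_zero order_trans)
  qed
  finally have "norm D * norm D \<le> norm D * (2 * \<delta> * norm W + 2 * sqrt (1 + \<delta>) * norm e)"
    by (simp add: power2_eq_square algebra_simps)
  then have D: "norm D \<le> 2 * \<delta> * norm W + 2 * sqrt (1 + \<delta>) * norm e"
    using \<open>0 \<le> \<delta>\<close> by (cases "D = 0") simp_all
  have "X' - Xr = D - (Z - X')" by (simp add: D_def)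
  then have "norm (X' - Xr) \<le> norm D + norm (Z - X')" by (simp only: norm_triangle_ineq4)
  with D norm_shrinkage_diff_le[OF X' \<open>0 \<le> \<mu>\<close>]
  show "norm (X' - Xr) \<le> 2 * \<delta> * norm (X - Xr) + 2 * sqrt (1 + \<delta>) * norm e + sqrt (real CARD('m)) * \<mu>"
    unfolding W_def by linarith
qed

text \<open>Writing the offset as \<open>(1 - \<alpha>) * c\<close> makes \<open>c\<close> the fixed
  point of the recursion, so the claimed bound reproduces itself at each step.\<close>

lemma affine_recursion_bound:
  fixes d :: "nat \<Rightarrow> real"
  assumes "0 \<le> \<alpha>" "0 \<le> c" and step: "\<And>k. k < n \<Longrightarrow> d (Suc k) \<le> \<alpha> * d k + (1 - \<alpha>) * c"
  shows "d n \<le> \<alpha> ^ n * d 0 + c"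
  using step
proof (induction n)
  case (Suc n)
  have "d (Suc n) \<le> \<alpha> * d n + (1 - \<alpha>) * c" by (rule Suc.prems) simp
  also have "\<alpha> * d n \<le> \<alpha> * (\<alpha> ^ n * d 0 + c)"
    using Suc \<open>0 \<le> \<alpha>\<close> by (intro mult_left_mono) simp_all
  finally show ?case by (simp add: algebra_simps)
qed (use \<open>0 \<le> c\<close> in simp)

text \<open>\<open>D j\<close> and \<open>E j\<close> are the errors at the start and the end of
  stage \<open>j\<close>. The offset \<open>c (j - 1)\<close> passes through stages \<open>j\<close>
  to \<open>L\<close> and is damped by all of them; only \<open>c L\<close> stays undamped.\<close>

lemma continuation_bound:
  fixes D E c :: "nat \<Rightarrow> real"
  assumes "0 \<le> \<alpha>" and stage: "\<And>j. j \<in> {1..L} \<Longrightarrow> E j \<le> \<alpha> ^ K j * D j + c j"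
    and link: "\<And>j. j \<in> {1..<L} \<Longrightarrow> D (Suc j) = E j" and "1 \<le> L"
  shows "E L \<le> \<alpha> ^ (\<Sum>j=1..L. K j) * D 1 + (\<Sum>j=2..L. \<alpha> ^ (\<Sum>l=j..L. K l) * c (j - 1)) + c L"
  using \<open>1 \<le> L\<close> stage link
proof (induction L rule: dec_induct)
  case base
  then show ?case by simp
next
  case (step L)
  have pow: "\<alpha> ^ (\<Sum>l=j..Suc L. K l) = \<alpha> ^ K (Suc L) * \<alpha> ^ (\<Sum>l=j..L. K l)" if "j \<le> Suc L" for j
    using that by (simp add: power_add)
  have "E (Suc L) \<le> \<alpha> ^ K (Suc L) * E L + c (Suc L)"
    using step.prems(1)[of "Suc L"] step.prems(2)[of L] step.hyps by simp
  also have "\<alpha> ^ K (Suc L) * E L \<le> \<alpha> ^ K (Suc L) *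
      (\<alpha> ^ (\<Sum>j=1..L. K j) * D 1 + (\<Sum>j=2..L. \<alpha> ^ (\<Sum>l=j..L. K l) * c (j - 1)) + c L)"
    using step \<open>0 \<le> \<alpha>\<close> by (intro mult_left_mono) simp_all
  also have "\<dots> = \<alpha> ^ (\<Sum>j=1..Suc L. K j) * D 1
      + (\<Sum>j=2..Suc L. \<alpha> ^ (\<Sum>l=j..Suc L. K l) * c (j - 1))"
  proof -
    \<comment> \<open>The formerly undamped \<open>c L\<close> becomes the new summand
      \<open>j = Suc L\<close>.\<close>
    have "(\<Sum>j=2..Suc L. \<alpha> ^ (\<Sum>l=j..Suc L. K l) * c (j - 1))
        = (\<Sum>j=2..L. \<alpha> ^ (\<Sum>l=j..Suc L. K l) * c (j - 1)) + \<alpha> ^ K (Suc L) * c L"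
      using step.hyps by simp
    also have "(\<Sum>j=2..L. \<alpha> ^ (\<Sum>l=j..Suc L. K l) * c (j - 1))
        = \<alpha> ^ K (Suc L) * (\<Sum>j=2..L. \<alpha> ^ (\<Sum>l=j..L. K l) * c (j - 1))"
      unfolding sum_distrib_left by (intro sum.cong refl) (simp add: power_add)
    finally show ?thesis using pow[of 1] by (simp add: distrib_left)
  qed
  finally show ?case by simp
qed

theorem theorem6p2:
  fixes A :: "real^'n^'m \<Rightarrow> real^'p"
    and b e :: "real^'p"
    and X Xr X0 :: "real^'n^'m"
    and r L :: nat
    and \<alpha> \<beta> \<gamma> \<epsilon> \<eta> \<mu>bar :: real
    and \<mu> :: "nat \<Rightarrow> real"
    and K :: "nat \<Rightarrow> nat"
    and Xs :: "nat \<Rightarrow> nat \<Rightarrow> real^'n^'m"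
  assumes "CARD('m) \<le> CARD('n)"
    and "linear A"
    and "b = A X + e"
    and "1 \<le> r" and "3 * r \<le> CARD('m)"
    and "is_hard_threshold r X Xr"
    and "0 < \<alpha>" and "\<alpha> < 1"
    and "ric A (3 * r) \<le> \<alpha> / sqrt 8"
    and "rank X0 \<le> r"
    and "continuation_schedule L \<mu> \<eta> \<mu>bar"
    and "fpcar_run A b r X0 L \<mu> K Xs"
    and "\<beta> = 2 * sqrt (1 + \<alpha> / sqrt 8)"
    and "\<gamma> = \<beta>\<^sup>2 / (2 * (1 - \<alpha>)) + 1"
    and "\<epsilon> = norm (X - Xr) + 1 / sqrt (real r) * nuclear_norm (X - Xr) + norm e"
  shows "norm (X - Xs L (K L)) \<le>
      \<alpha> ^ (\<Sum>j=1..L. K j) * norm (Xr - X0)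
      + (((\<Sum>j=2..L. \<alpha> ^ (\<Sum>l=j..L. K l)) + 1) * \<gamma> + 1) * \<epsilon>
      + ((\<Sum>j=2..L. \<alpha> ^ (\<Sum>l=j..L. K l) * \<mu> (j - 1)) + \<mu> L)
        * (2 * sqrt (real CARD('m)) / (1 - \<alpha>))"
proof -
  define \<delta> T where "\<delta> = \<alpha> / sqrt 8" and "T = 2 * sqrt (real CARD('m)) / (1 - \<alpha>)"
  \<comment> \<open>Fixed point of the error recursion in stage \<open>j\<close>, split into noise
    and shrinkage.\<close>
  define c where "c j = \<gamma> * \<epsilon> + \<mu> j * T" for j
  note rip = ric_bounds[OF assms(2) _ _ assms(9), folded \<delta>_def]
  have r: "1 \<le> r" "r \<le> CARD('m)" "1 \<le> 3 * r" using assms(4,5) by simp_all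
  have "2 \<le> sqrt 8" by (rule real_le_rsqrt) simp
  then have \<delta>: "0 \<le> \<delta>" "2 * \<delta> \<le> \<alpha>" using assms(7) by (simp_all add: \<delta>_def field_simps)
  have T: "0 \<le> T" "(1 - \<alpha>) * T = 2 * sqrt (real CARD('m))" using assms(8) by (simp_all add: T_def)
  obtain \<sigma> u v where svd: "is_svd (X - Xr) \<sigma> u v"
    by (rule hard_threshold_residual_is_svd[OF assms(6) r(2)])
  have "0 \<le> nuclear_norm (X - Xr)"
    unfolding nuclear_norm_eq[OF svd] by (intro sum_nonneg is_svdD(1)[OF svd])
  then have \<epsilon>: "0 \<le> \<epsilon>" unfolding assms(15) by simp
  \<comment> \<open>Since \<open>\<beta> = 2 * sqrt (1 + \<delta>)\<close>, the term
    \<open>\<beta>\<^sup>2 / 2\<close> is \<open>2 * (1 + \<delta>)\<close>, the factor that the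
    noise picks up in one step.\<close>
  have \<gamma>: "(1 - \<alpha>) * \<gamma> = 2 * (1 + \<delta>) + (1 - \<alpha>)"
    unfolding assms(14) assms(13) using assms(8) \<delta>(1)
    by (simp add: \<delta>_def[symmetric] power_mult_distrib field_simps)
  have \<gamma>_nonneg: "0 \<le> \<gamma>" unfolding assms(14) using assms(8) by simp
  define e' where "e' = A (X - Xr) + e"
  have b: "b = A Xr + e'" by (simp add: assms(3) e'_def linear_diff[OF assms(2)])
  have "norm (A (X - Xr)) \<le> sqrt (1 + \<delta>) * (norm (X - Xr) + 1 / sqrt (real r) * nuclear_norm (X - Xr))"
  proof (rule norm_image_le_frobenius_nuclear[OF assms(2) _ _ r(1,2) svd])
    fix M :: "real^'n^'m" assume "rank M \<le> r"
    then have "(norm (A M))\<^sup>2 \<le> (sqrt (1 + \<delta>) * norm M)\<^sup>2"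
      using rip(2)[OF r(3), of M] \<delta>(1) by (simp add: power_mult_distrib)
    then show "norm (A M) \<le> sqrt (1 + \<delta>) * norm M"
      by (rule power2_le_imp_le) (use \<delta>(1) in simp)
  qed (use \<delta>(1) in simp)
  moreover have "norm e \<le> sqrt (1 + \<delta>) * norm e"
    using mult_right_mono[of 1 "sqrt (1 + \<delta>)" "norm e"] \<delta>(1) by simp
  ultimately have "norm e' \<le> sqrt (1 + \<delta>) * \<epsilon>"
    unfolding e'_def assms(15) using norm_triangle_ineq[of "A (X - Xr)" e] by (simp add: distrib_left)
  then have "2 * sqrt (1 + \<delta>) * norm e' \<le> 2 * sqrt (1 + \<delta>) * (sqrt (1 + \<delta>) * \<epsilon>)"
    by (rule mult_left_mono) (use \<delta>(1) in simp)
  also have "\<dots> = 2 * (1 + \<delta>) * \<epsilon>" using \<delta>(1) by simp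
  also have "\<dots> \<le> (1 - \<alpha>) * (\<gamma> * \<epsilon>)"
    using \<epsilon> assms(8) unfolding mult.assoc[symmetric] \<gamma> by (intro mult_right_mono) simp_all
  finally have e': "2 * sqrt (1 + \<delta>) * norm e' \<le> (1 - \<alpha>) * (\<gamma> * \<epsilon>)" .
  have L: "1 \<le> L" and \<mu>_last: "0 < \<mu>bar" "\<mu> L = \<mu>bar"
    and \<mu>_Suc: "\<And>j. j \<in> {1..<L} \<Longrightarrow> \<mu> (Suc j) < \<mu> j"
      "\<And>j. j \<in> {1..<L} \<Longrightarrow> \<mu> (Suc j) = max (\<mu> j * \<eta>) \<mu>bar"
    using assms(11) unfolding continuation_schedule_def by blast+
  \<comment> \<open>Before the last stage, \<open>\<mu> j\<close> exceeds its successor, which is a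
    maximum with \<open>\<mu>bar\<close>.\<close>
  have \<mu>: "0 < \<mu> j" if "j \<in> {1..L}" for j
  proof (cases "j = L")
    case True
    then show ?thesis using \<mu>_last by simp
  next
    case False
    then have "j \<in> {1..<L}" using that by simp
    from \<mu>_Suc[OF this] \<mu>_last(1) show ?thesis by linarith
  qed
  have run: "Xs 1 0 = X0" "\<And>j k. j \<in> {1..L} \<Longrightarrow> k < K j \<Longrightarrow> fpcar_step A b r (\<mu> j) (Xs j k) (Xs j (Suc k))"
    "\<And>j. j \<in> {1..<L} \<Longrightarrow> Xs (Suc j) 0 = Xs j (K j)"
    using assms(12) unfolding fpcar_run_def by simp_all
  note rank_Xr = rank_hard_threshold_le[OF assms(6)]
  note step = fpcar_step_error[OF assms(2) rip[OF r(3)] \<delta>(1) b rank_Xr _ r(1,2)]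
  have rank_stage: "rank (Xs j k) \<le> r" if "j \<in> {1..L}" "k \<le> K j" "rank (Xs j 0) \<le> r" for j k
    using that(2)
  proof (induction k)
    case (Suc k)
    then show ?case using step(1)[OF _ _ _ run(2)[OF that(1)]] \<mu>[OF that(1)] by simp
  qed (use that(3) in simp)
  \<comment> \<open>A stage may consist of zero iterations, so the rank bound is carried from stage
    to stage, starting at \<open>X0\<close>.\<close>
  have rank0: "rank (Xs j 0) \<le> r" if "1 \<le> j" "j \<le> L" for j
    using that
  proof (induction j rule: dec_induct)
    case (step j)
    then show ?case using rank_stage[of j "K j"] run(3)[of j] by simp
  qed (use assms(10) run(1) in simp)
  have stage: "norm (Xs j (K j) - Xr) \<le> \<alpha> ^ K j * norm (Xs j 0 - Xr) + c j" if j: "j \<in> {1..L}" for j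
  proof (rule affine_recursion_bound)
    show "0 \<le> c j" unfolding c_def using \<gamma>_nonneg \<epsilon> T(1) \<mu>[OF j] by simp
    fix k assume k: "k < K j"
    have "rank (Xs j k) \<le> r" using rank_stage[OF j] rank0 j k by simp
    then have "norm (Xs j (Suc k) - Xr) \<le> 2 * \<delta> * norm (Xs j k - Xr) + 2 * sqrt (1 + \<delta>) * norm e'
        + sqrt (real CARD('m)) * \<mu> j"
      using step(2)[OF _ _ _ run(2)[OF j k]] \<mu>[OF j] by simp
    moreover have "2 * \<delta> * norm (Xs j k - Xr) \<le> \<alpha> * norm (Xs j k - Xr)"
      using \<delta>(2) by (rule mult_right_mono) simp
    \<comment> \<open>The factor 2 in \<open>T\<close> leaves half of the right side to
      spare.\<close>
    moreover have "sqrt (real CARD('m)) * \<mu> j \<le> (1 - \<alpha>) * (\<mu> j * T)"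
    proof -
      have "(1 - \<alpha>) * (\<mu> j * T) = 2 * (sqrt (real CARD('m)) * \<mu> j)"
        unfolding mult.left_commute[of "1 - \<alpha>"] T(2) by simp
      moreover have "0 \<le> sqrt (real CARD('m)) * \<mu> j" using \<mu>[OF j] by simp
      ultimately show ?thesis by linarith
    qed
    ultimately show "norm (Xs j (Suc k) - Xr) \<le> \<alpha> * norm (Xs j k - Xr) + (1 - \<alpha>) * c j"
      using e' unfolding c_def distrib_left by linarith
  qed (use assms(7) in simp)
  have "norm (Xs L (K L) - Xr) \<le> \<alpha> ^ (\<Sum>j=1..L. K j) * norm (Xs 1 0 - Xr)
      + (\<Sum>j=2..L. \<alpha> ^ (\<Sum>l=j..L. K l) * c (j - 1)) + c L"
    by (rule continuation_bound[where D = "\<lambda>j. norm (Xs j 0 - Xr)"])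
      (use assms(7) stage run(3) L in simp_all)
  \<comment> \<open>The recursion measures the distance to \<open>Xr\<close>; returning to
    \<open>X\<close> costs one more \<epsilon>, the final \<open>+ 1\<close> in its
    coefficient.\<close>
  moreover have "norm (X - Xs L (K L)) \<le> norm (X - Xr) + norm (Xs L (K L) - Xr)"
    using norm_triangle_ineq4[of "X - Xr" "Xs L (K L) - Xr"] by simp
  moreover have "norm (X - Xr) \<le> \<epsilon>"
    unfolding assms(15) using \<open>0 \<le> nuclear_norm (X - Xr)\<close> by simp
  moreover have "(\<Sum>j=2..L. \<alpha> ^ (\<Sum>l=j..L. K l) * c (j - 1))
      = (\<Sum>j=2..L. \<alpha> ^ (\<Sum>l=j..L. K l)) * (\<gamma> * \<epsilon>) + (\<Sum>j=2..L. \<alpha> ^ (\<Sum>l=j..L. K l) * \<mu> (j - 1)) * T"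
    by (simp add: c_def distrib_left sum.distrib sum_distrib_right mult.assoc)
  moreover have "norm (Xs 1 0 - Xr) = norm (Xr - X0)" unfolding run(1) by (rule norm_minus_commute)
  ultimately show ?thesis
    unfolding T_def[symmetric] c_def by (simp add: algebra_simps)
qed

end
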